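(* Let $(X,\mathcal A,m)$ and $(\Omega,\mathcal F,\mathbb P)$ be probability spaces and $\sigma:\Omega\to\Omega$ a $\mathbb P$-preserving transformation. Let $T:X\to X$ be a measurably bijective map (up to sets of zero $m$-measure) preserving $m$ such that the Perron–Frobenius operator $L_T$ associated with $T$ is mixing. Assume that there is a set $\Omega_0$ of positive $\mathbb P$-measure such that the forward orbit of each $\omega\in\Omega_0$ under $\sigma$ is measurable but not finite, and let $(P,\sigma)$ be a Markov operator cocycle with $P_\omega=L_T$ for all $\omega\in\Omega_0$. Then $(P,\sigma)$ is not prior mixing for inhomogeneous observables in $B(\Omega,L^\infty(X,m))$.
   Context: The Perron–Frobenius operator $L_T:L^1(X,m)\to L^1(X,m)$ of a non-singular map $T$ (i.e. the pushforward $T_*m$ is absolutely continuous with respect to $m$) satisfies $\int_X L_Tf\cdot g\,dm=\int_X f\cdot g\circ T\,dm$ for $f\in L^1(X,m)$, $g\in L^\infty(X,m)$. Here $L_T1_X=1_X$ since $T$ preserves $m$, and $L_T$ is mixing if $\int_X L_T^nf\cdot g\,dm\to\int_X f\,dm\int_X g\,dm$ as $n\to\infty$ for all $f\in L^1(X,m)$, $g\in L^\infty(X,m)$. (The baker map is an example of such a $T$; an example of the base is $\Omega=[0,1]$ with Lebesgue measure and $\sigma$ the tent map.) A Markov operator on $L^1(X,m)$ is a linear positive operator preserving the integral $\int_X\cdot\,dm$. A Markov operator cocycle $(P,\sigma)$ is given by a measurable map $P:\Omega\times L^1(X,m)\to L^1(X,m)$ such that $P_\omega=P(\omega,\cdot)$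 is a Markov operator for $\mathbb P$-almost every $\omega$; set $P^{(n)}_\omega=P_{\sigma^{n-1}\omega}\circ\cdots\circ P_{\sigma\omega}\circ P_\omega$. $L^1_0(X,m)=\{f\in L^1(X,m):\int_X f\,dm=0\}$. $B(\Omega,L^\infty(X,m))$ is the set of all bounded measurable maps $g:\Omega\to L^\infty(X,m)$, $\omega\mapsto g_\omega$ (maps, not equivalence classes). Prior mixing for inhomogeneous observables in $B(\Omega,L^\infty(X,m))$ means: for $\mathbb P$-almost every $\omega$, for all $f\in L^1_0(X,m)$ and all $g\in B(\Omega,L^\infty(X,m))$, $\lim_{n\to\infty}\int_X P^{(n)}_\omega f\cdot g_{\sigma^n\omega}\,dm=0$ (the full-measure set of $\omega$ does not depend on $f,g$).
   Formalization: P_ω = L_T is assumed along the whole forward orbit of each point of Ω_0, not only on Ω_0, and X is assumed to have a measurable set of measure strictly between 0 and 1; without either of these the claim is false. *)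

theory Defs
  imports "HOL-Probability.Probability" "HOL-Probability.Essential_Supremum"
begin

text \<open>
  Points of \<open>L\<^sup>1\<close> and \<open>L\<^sup>\<infinity>\<close> are represented by functions, and two of them are the same point iff
  they agree almost everywhere. Operators are therefore required to respect
  almost-everywhere equality, and are compared up to it.
\<close>

definition L1 :: "'x measure \<Rightarrow> ('x \<Rightarrow> real) set" where
  "L1 M = {f. integrable M f}"

definition L1_zero :: "'x measure \<Rightarrow> ('x \<Rightarrow> real) set" where
  "L1_zero M = {f \<in> L1 M. (\<integral>x. f x \<partial>M) = 0}"

definition L1_norm :: "'x measure \<Rightarrow> ('x \<Rightarrow> real) \<Rightarrow> real" where
  "L1_norm M f = (\<integral>x. \<bar>f x\<bar> \<partial>M)"

definition Linf :: "'x measure \<Rightarrow> ('x \<Rightarrow> real) set" where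
  "Linf M = {g \<in> borel_measurable M. esssup M (\<lambda>x. ereal \<bar>g x\<bar>) < \<infinity>}"

definition Linf_norm :: "'x measure \<Rightarrow> ('x \<Rightarrow> real) \<Rightarrow> real" where
  "Linf_norm M g = real_of_ereal (esssup M (\<lambda>x. ereal \<bar>g x\<bar>))"

text \<open>
  The Borel \<open>\<sigma>\<close>-algebra of a seminorm \<open>N\<close> on \<open>S\<close>. Seminorm-open sets are
  saturated, so for \<open>L\<^sup>1\<close> and \<open>L\<^sup>\<infinity>\<close> this is precisely the pullback of the Borel \<open>\<sigma>\<close>-algebra of the
  normed space of equivalence classes along the quotient map.
\<close>

definition seminorm_borel ::
    "('x \<Rightarrow> real) set \<Rightarrow> (('x \<Rightarrow> real) \<Rightarrow> real) \<Rightarrow> ('x \<Rightarrow> real) measure" where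
  "seminorm_borel S N =
     sigma S {U. U \<subseteq> S \<and> (\<forall>f\<in>U. \<exists>e>0. \<forall>h\<in>S. N (\<lambda>x. h x - f x) < e \<longrightarrow> h \<in> U)}"

definition L1_space :: "'x measure \<Rightarrow> ('x \<Rightarrow> real) measure" where
  "L1_space M = seminorm_borel (L1 M) (L1_norm M)"

definition Linf_space :: "'x measure \<Rightarrow> ('x \<Rightarrow> real) measure" where
  "Linf_space M = seminorm_borel (Linf M) (Linf_norm M)"

definition L1_operator :: "'x measure \<Rightarrow> (('x \<Rightarrow> real) \<Rightarrow> ('x \<Rightarrow> real)) \<Rightarrow> bool" where
  "L1_operator M Q \<longleftrightarrow>
     (\<forall>f\<in>L1 M. Q f \<in> L1 M) \<and>
     (\<forall>f\<in>L1 M. \<forall>h\<in>L1 M. (AE x in M. f x = h x) \<longrightarrow> (AE x in M. Q f x = Q h x))"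

definition L1_operator_eq ::
    "'x measure \<Rightarrow> (('x \<Rightarrow> real) \<Rightarrow> ('x \<Rightarrow> real)) \<Rightarrow> (('x \<Rightarrow> real) \<Rightarrow> ('x \<Rightarrow> real)) \<Rightarrow> bool" where
  "L1_operator_eq M Q R \<longleftrightarrow> (\<forall>f\<in>L1 M. AE x in M. Q f x = R f x)"

definition markov_operator :: "'x measure \<Rightarrow> (('x \<Rightarrow> real) \<Rightarrow> ('x \<Rightarrow> real)) \<Rightarrow> bool" where
  "markov_operator M Q \<longleftrightarrow>
     L1_operator M Q \<and>
     (\<forall>f\<in>L1 M. \<forall>h\<in>L1 M. \<forall>a b.
        AE x in M. Q (\<lambda>y. a * f y + b * h y) x = a * Q f x + b * Q h x) \<and>
     (\<forall>f\<in>L1 M. (AE x in M. 0 \<le> f x) \<longrightarrow> (AE x in M. 0 \<le> Q f x)) \<and>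
     (\<forall>f\<in>L1 M. (\<integral>x. Q f x \<partial>M) = (\<integral>x. f x \<partial>M))"

definition preserves_measure :: "'x measure \<Rightarrow> ('x \<Rightarrow> 'x) \<Rightarrow> bool" where
  "preserves_measure M T \<longleftrightarrow> T \<in> measurable M M \<and> distr M M T = M"

definition measurably_bijective_mod_null :: "'x measure \<Rightarrow> ('x \<Rightarrow> 'x) \<Rightarrow> bool" where
  "measurably_bijective_mod_null M T \<longleftrightarrow>
     (\<exists>N1\<in>null_sets M. \<exists>N2\<in>null_sets M.
        bij_betw T (space M - N1) (space M - N2) \<and>
        T \<in> measurable (restrict_space M (space M - N1)) (restrict_space M (space M - N2)) \<and>
        the_inv_into (space M - N1) T
          \<in> measurable (restrict_space M (space M - N2)) (restrict_space M (space M - N1)))"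

text \<open>
  The Perron--Frobenius operator. For non-singular \<open>T\<close> and integrable \<open>f\<close> the choice below exists
  and is unique up to almost-everywhere equality.
\<close>

definition perron_frobenius ::
    "'x measure \<Rightarrow> ('x \<Rightarrow> 'x) \<Rightarrow> ('x \<Rightarrow> real) \<Rightarrow> ('x \<Rightarrow> real)" where
  "perron_frobenius M T f =
     (SOME h. h \<in> L1 M \<and>
        (\<forall>g\<in>Linf M. (\<integral>x. h x * g x \<partial>M) = (\<integral>x. f x * g (T x) \<partial>M)))"

definition mixing_operator :: "'x measure \<Rightarrow> (('x \<Rightarrow> real) \<Rightarrow> ('x \<Rightarrow> real)) \<Rightarrow> bool" where
  "mixing_operator M Q \<longleftrightarrow>
     (\<forall>f\<in>L1 M. \<forall>g\<in>Linf M.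
        (\<lambda>n. \<integral>x. (Q ^^ n) f x * g x \<partial>M) \<longlonglongrightarrow> (\<integral>x. f x \<partial>M) * (\<integral>x. g x \<partial>M))"

definition forward_orbit :: "('w \<Rightarrow> 'w) \<Rightarrow> 'w \<Rightarrow> 'w set" where
  "forward_orbit \<sigma> \<omega> = range (\<lambda>n. (\<sigma> ^^ n) \<omega>)"

definition markov_operator_cocycle ::
    "'w measure \<Rightarrow> 'x measure \<Rightarrow> ('w \<Rightarrow> ('x \<Rightarrow> real) \<Rightarrow> ('x \<Rightarrow> real)) \<Rightarrow> bool" where
  "markov_operator_cocycle \<Omega> M P \<longleftrightarrow>
     (\<lambda>(\<omega>, f). P \<omega> f) \<in> measurable (\<Omega> \<Otimes>\<^sub>M L1_space M) (L1_space M) \<and>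
     (\<forall>\<omega>\<in>space \<Omega>. L1_operator M (P \<omega>)) \<and>
     (AE \<omega> in \<Omega>. markov_operator M (P \<omega>))"

fun cocycle_iterate ::
    "('w \<Rightarrow> 'w) \<Rightarrow> ('w \<Rightarrow> ('x \<Rightarrow> real) \<Rightarrow> ('x \<Rightarrow> real)) \<Rightarrow> nat \<Rightarrow> 'w \<Rightarrow> ('x \<Rightarrow> real) \<Rightarrow> ('x \<Rightarrow> real)"
where
  "cocycle_iterate \<sigma> P 0 \<omega> = id"
| "cocycle_iterate \<sigma> P (Suc n) \<omega> = P ((\<sigma> ^^ n) \<omega>) \<circ> cocycle_iterate \<sigma> P n \<omega>"

definition bounded_observables :: "'w measure \<Rightarrow> 'x measure \<Rightarrow> ('w \<Rightarrow> 'x \<Rightarrow> real) set" where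
  "bounded_observables \<Omega> M =
     {g \<in> measurable \<Omega> (Linf_space M). \<exists>C. \<forall>\<omega>\<in>space \<Omega>. Linf_norm M (g \<omega>) \<le> C}"

definition prior_mixing_inhomogeneous ::
    "'w measure \<Rightarrow> ('w \<Rightarrow> 'w) \<Rightarrow> 'x measure \<Rightarrow> ('w \<Rightarrow> ('x \<Rightarrow> real) \<Rightarrow> ('x \<Rightarrow> real)) \<Rightarrow> bool" where
  "prior_mixing_inhomogeneous \<Omega> \<sigma> M P \<longleftrightarrow>
     (AE \<omega> in \<Omega>. \<forall>f\<in>L1_zero M. \<forall>g\<in>bounded_observables \<Omega> M.
        (\<lambda>n. \<integral>x. cocycle_iterate \<sigma> P n \<omega> f x * g ((\<sigma> ^^ n) \<omega>) x \<partial>M) \<longlonglongrightarrow> 0)"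

end

theory Submission
  imports Defs
begin

text \<open>
  By recurrence, almost every point of \<open>\<Omega>0\<close> returns to \<open>\<Omega>0\<close> infinitely often, so its orbit
  contains tails of arbitrarily high index that are measurable. Pulling such tails back along \<open>\<sigma>\<close>
  makes every tail of the orbit, hence every single orbit point, measurable. An observable on the
  orbit may therefore be prescribed point by point, and it can follow the dynamics of \<open>T\<close>: take
  \<open>f = 1\<^sub>A - m A\<close> and let the observable at \<open>\<sigma>\<^sup>n \<omega>\<close> be the indicator of \<open>T\<^sup>n A\<close>. Since \<open>T\<close> is
  invertible, the correlations equal \<open>m A (1 - m A)\<close> for all \<open>n\<close>.
\<close>

section \<open>Recurrence and measurability of single orbit points\<close>

lemma measurable_funpow:
  assumes "f \<in> measurable M M"
  shows "f ^^ n \<in> measurable M M"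
proof (induction n)
  case 0
  show ?case by (simp add: id_def)
next
  case (Suc n)
  then show ?case using assms by (simp add: measurable_comp)
qed

lemma preserves_measure_vimage:
  assumes "preserves_measure M f" "A \<in> sets M"
  shows "emeasure M (f -` A \<inter> space M) = emeasure M A"
  using assms emeasure_distr[of f M M A] by (simp add: preserves_measure_def)

text \<open>Poincare recurrence: the points visiting \<open>A\<close> at some time
  \<open>\<ge> n\<close> form decreasing sets, each the preimage of the one before. Invariance gives
  them all the same finite measure, so they differ by null sets only.\<close>

lemma AE_infinitely_recurrent:
  assumes "prob_space M" and pres: "preserves_measure M f" and A: "A \<in> sets M"
  shows "AE x in M. x \<in> A \<longrightarrow> (\<forall>n. \<exists>k\<ge>n. (f ^^ k) x \<in> A)"
proof -
  interpret prob_space M by fact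
  have f: "f \<in> measurable M M" using pres by (simp add: preserves_measure_def)
  note [measurable] = measurable_funpow[OF f] A
  define B where "B n = {x \<in> space M. \<exists>k\<ge>n. (f ^^ k) x \<in> A}" for n
  have B[measurable]: "B n \<in> sets M" for n unfolding B_def by measurable
  have vimage: "f -` B n \<inter> space M = B (Suc n)" for n
  proof -
    have "(\<exists>k\<ge>n. (f ^^ k) (f x) \<in> A) \<longleftrightarrow> (\<exists>k\<ge>Suc n. (f ^^ k) x \<in> A)" for x
    proof -
      have "(\<exists>k\<ge>n. (f ^^ k) (f x) \<in> A) \<longleftrightarrow> (\<exists>k\<ge>n. (f ^^ Suc k) x \<in> A)"
        by (simp only: funpow_Suc_right comp_apply)
      also have "\<dots> \<longleftrightarrow> (\<exists>k\<ge>Suc n. (f ^^ k) x \<in> A)"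
        by (metis Suc_le_D Suc_le_mono)
      finally show ?thesis .
    qed
    then show ?thesis using measurable_space[OF f] by (auto simp: B_def)
  qed
  have em: "emeasure M (B n) = emeasure M (B 0)" for n
    by (induction n) (simp_all add: preserves_measure_vimage[OF pres B] flip: vimage)
  have "AE x in M. x \<notin> B 0 - B n" for n
  proof -
    have "B n \<subseteq> B 0" by (auto simp: B_def)
    then have "emeasure M (B 0 - B n) = 0"
      using emeasure_Diff[of M "B n" "B 0"] B by (simp add: em[of n])
    then show ?thesis by (intro AE_not_in) (auto simp: null_sets_def)
  qed
  then have "AE x in M. \<forall>n. x \<notin> B 0 - B n" by (intro AE_all_countable[THEN iffD2] allI)
  then show ?thesis
  proof eventually_elim
    case (elim x)
    show ?case
    proof (intro impI allI)
      fix n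
      assume "x \<in> A"
      \<comment> \<open>Time 0 counts as a visit, so \<open>A\<close> lies in
        \<open>B 0\<close>.\<close>
      then have "(f ^^ 0) x \<in> A" "x \<in> space M" using sets.sets_into_space[OF A] by auto
      then have "x \<in> B 0" unfolding B_def by blast
      with elim show "\<exists>k\<ge>n. (f ^^ k) x \<in> A" by (auto simp: B_def)
    qed
  qed
qed

text \<open>A coincidence at times \<open>i < j\<close> makes the orbit periodic from time
  \<open>i\<close> on, so its first \<open>j\<close> points exhaust it.\<close>

lemma inj_funpow_if_infinite_forward_orbit:
  assumes "infinite (forward_orbit f x)"
  shows "inj (\<lambda>n. (f ^^ n) x)"
proof (rule linorder_inj_onI')
  fix i j :: nat
  assume "i < j"
  show "(f ^^ i) x \<noteq> (f ^^ j) x"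
  proof
    assume eq: "(f ^^ i) x = (f ^^ j) x"
    \<comment> \<open>A time \<open>n \<ge> j\<close> can be replaced by the smaller time
      \<open>n - j + i\<close>.\<close>
    have "(f ^^ n) x \<in> (\<lambda>n. (f ^^ n) x) ` {..<j}" for n
    proof (induction n rule: less_induct)
      case (less n)
      show ?case
      proof (cases "n < j")
        case False
        then have "(f ^^ n) x = (f ^^ (n - j)) ((f ^^ j) x)"
          using funpow_add[of "n - j" j f] by (simp add: fun_eq_iff)
        also have "\<dots> = (f ^^ (n - j)) ((f ^^ i) x)" by (simp only: eq)
        also have "\<dots> = (f ^^ (n - j + i)) x" by (simp add: funpow_add)
        finally show ?thesis using less[of "n - j + i"] False \<open>i < j\<close> by simp
      qed auto
    qed
    then have "forward_orbit f x \<subseteq> (\<lambda>n. (f ^^ n) x) ` {..<j}"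
      by (auto simp: forward_orbit_def)
    with assms show False using finite_subset by blast
  qed
qed

text \<open>Measurable tails are given only for arbitrarily late starting times \<open>k\<close>.
  The tail from an earlier \<open>n\<close> consists of the orbit points that enter the tail from
  \<open>k\<close> after \<open>k - n\<close> steps, and a single point is the difference of two
  consecutive tails.\<close>

lemma sets_singleton_forward_orbit:
  assumes f: "f \<in> measurable M M"
    and inj: "inj (\<lambda>n. (f ^^ n) x)"
    and orbit: "forward_orbit f x \<in> sets M"
    and rec: "\<And>n. \<exists>k\<ge>n. forward_orbit f ((f ^^ k) x) \<in> sets M"
  shows "{(f ^^ n) x} \<in> sets M"
proof -
  define tail where "tail n = (\<lambda>i. (f ^^ i) x) ` {n..}" for n
  have forward_orbit_eq_tail: "forward_orbit f ((f ^^ k) x) = tail k" for k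
  proof -
    have "forward_orbit f ((f ^^ k) x) = (\<lambda>i. (f ^^ i) x) ` range (\<lambda>i. i + k)"
      by (simp add: forward_orbit_def funpow_add image_image)
    also have "range (\<lambda>i. i + k) = {k..}"
      by (auto simp: image_iff intro: le_add_diff_inverse2[symmetric])
    finally show ?thesis by (simp add: tail_def)
  qed
  have tail: "tail n \<in> sets M" for n
  proof -
    obtain k where k: "k \<ge> n" "tail k \<in> sets M"
      using rec forward_orbit_eq_tail by metis
    have mem_tail: "(f ^^ i) x \<in> tail m \<longleftrightarrow> m \<le> i" for i m
      using inj by (auto simp: tail_def inj_def)
    have "(f ^^ (k - n)) ((f ^^ i) x) \<in> tail k \<longleftrightarrow> n \<le> i" for i
    proof -
      have "(f ^^ (k - n)) ((f ^^ i) x) = (f ^^ (k - n + i)) x" by (simp add: funpow_add)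
      then show ?thesis using k mem_tail[of "k - n + i" k] by auto
    qed
    \<comment> \<open>Points off the orbit may also be sent into \<open>tail k\<close>; intersecting
      with the measurable orbit removes them.\<close>
    then have "tail n = forward_orbit f x \<inter> ((f ^^ (k - n)) -` tail k \<inter> space M)"
      using sets.sets_into_space[OF orbit] by (auto simp: tail_def forward_orbit_def)
    then show ?thesis
      using orbit measurable_sets[OF measurable_funpow[OF f] k(2)] by auto
  qed
  have "{(f ^^ n) x} = tail n - tail (Suc n)"
  proof -
    have "tail n - tail (Suc n) = (\<lambda>i. (f ^^ i) x) ` ({n..} - {Suc n..})"
      unfolding tail_def by (rule image_set_diff[OF inj, symmetric])
    also have "{n..} - {Suc n..} = {n}" by auto
    finally show ?thesis by simp
  qed
  with tail show ?thesis by simp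
qed

section \<open>Observables prescribed along a sequence of points\<close>

text \<open>The sets of \<open>N\<close> are arbitrary: a preimage is a countable union of
  measurable points, possibly joined with the complement of the range. For L^infinity this avoids
  any separability question.\<close>

lemma measurable_countably_many_values:
  assumes x: "\<And>n::nat. {x n} \<in> sets M"
    and g: "g \<in> space M \<rightarrow> space N"
    and const: "\<And>y. y \<in> space M - range x \<Longrightarrow> g y = c"
  shows "g \<in> measurable M N"
proof (rule measurableI)
  fix B
  assume "B \<in> sets N"
  have x_space: "x n \<in> space M" for n using sets.sets_into_space[OF x[of n]] by simp
  have countable: "x ` I \<in> sets M" for I
    using sets.countable_UN''[of I "\<lambda>n. {x n}" M] x by (simp add: UNION_singleton_eq_range)
  have "g -` B \<inter> space M
      = x ` {n. g (x n) \<in> B} \<union> (if c \<in> B then space M - range x else {})"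
    using const x_space by auto
  also have "\<dots> \<in> sets M" using countable by auto
  finally show "g -` B \<inter> space M \<in> sets M" .
qed (use g in auto)

lemma space_Linf_space: "space (Linf_space M) = Linf M"
  unfolding Linf_space_def seminorm_borel_def by (intro space_measure_of) auto

lemma
  assumes [measurable]: "A \<in> sets M"
  shows indicator_in_Linf: "indicator A \<in> Linf M"
    and Linf_norm_indicator_le: "Linf_norm M (indicator A) \<le> 1"
proof -
  let ?e = "esssup M (\<lambda>x. ereal \<bar>indicator A x\<bar>)"
  have e: "?e \<le> 1"
    by (rule esssup_I) (auto simp: indicator_def)
  then have "?e < \<infinity>" using less_le_trans by fastforce
  then show "indicator A \<in> Linf M" by (simp add: Linf_def)
  \<comment> \<open>If the whole space is null, \<open>?e\<close> is minus infinity, which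
    \<open>real_of_ereal\<close> sends to 0.\<close>
  show "Linf_norm M (indicator A) \<le> 1"
    using e unfolding Linf_norm_def by (cases ?e) auto
qed

lemma in_bounded_observables:
  assumes x: "\<And>n::nat. {x n} \<in> sets \<Omega>" and "inj x" and A: "\<And>n. A n \<in> sets M"
  obtains g where "g \<in> bounded_observables \<Omega> M" "\<And>n. g (x n) = indicator (A n)"
proof
  \<comment> \<open>Injectivity lets \<open>inv x\<close> recover the index. Off the sequence the
    value is the zero function, written as the indicator of the empty set.\<close>
  define g :: "'a \<Rightarrow> 'b \<Rightarrow> real"
    where "g y = indicator (if y \<in> range x then A (inv x y) else {})" for y
  have "g y \<in> Linf M" "Linf_norm M (g y) \<le> 1" for y
    unfolding g_def using A by (auto intro!: indicator_in_Linf Linf_norm_indicator_le)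
  moreover have "g \<in> measurable \<Omega> (Linf_space M)"
    by (rule measurable_countably_many_values[OF x, where c = "indicator {}"])
      (use calculation in \<open>auto simp: space_Linf_space g_def\<close>)
  ultimately show "g \<in> bounded_observables \<Omega> M" by (auto simp: bounded_observables_def)
  show "g (x n) = indicator (A n)" for n by (simp add: g_def \<open>inj x\<close>)
qed

section \<open>Images under \<open>T\<close> and the duality of the Perron-Frobenius
  operator\<close>

text \<open>\<open>A'\<close> plays the role of the image of \<open>A\<close>. Taking it as a
  preimage under the inverse of \<open>T\<close> makes it measurable.\<close>

lemma bij_mod_null_obtain_image:
  assumes "measurably_bijective_mod_null M T" "A \<in> sets M"
  obtains A' where "A' \<in> sets M" "AE x in M. T x \<in> A' \<longleftrightarrow> x \<in> A"
proof -
  from assms(1) obtain N1 N2 where N: "N1 \<in> null_sets M" "N2 \<in> null_sets M"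
    and bij: "bij_betw T (space M - N1) (space M - N2)"
    and inv: "the_inv_into (space M - N1) T
      \<in> measurable (restrict_space M (space M - N2)) (restrict_space M (space M - N1))"
    unfolding measurably_bijective_mod_null_def by blast
  let ?S = "the_inv_into (space M - N1) T"
  define A' where "A' = {y \<in> space M - N2. ?S y \<in> A}"
  have "?S \<in> measurable (restrict_space M (space M - N2)) M"
    using inv by (simp add: measurable_restrict_space2_iff)
  from measurable_sets[OF this assms(2)] have "A' \<in> sets (restrict_space M (space M - N2))"
    by (simp add: A'_def space_restrict_space vimage_def Int_def conj_ac)
  then have "A' \<in> sets M"
    using N by (subst (asm) sets_restrict_space_iff) auto
  moreover have "AE x in M. T x \<in> A' \<longleftrightarrow> x \<in> A"
    using AE_not_in[OF N(1)] AE_space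
  proof eventually_elim
    case (elim x)
    then have "T x \<in> space M - N2" "?S (T x) = x"
      using bij by (auto simp: bij_betw_def intro!: the_inv_into_f_f)
    then show ?case by (simp add: A'_def)
  qed
  ultimately show ?thesis using that by blast
qed

text \<open>\<open>h\<close> is \<open>f\<close> composed with the inverse of \<open>T\<close>, set
  to 0 where that inverse is not controlled. It is the explicit form of the Perron-Frobenius image
  of \<open>f\<close>.\<close>

lemma bij_mod_null_obtain_factor:
  fixes f :: "'a \<Rightarrow> real"
  assumes "measurably_bijective_mod_null M T" and f: "f \<in> borel_measurable M"
  obtains h where "h \<in> borel_measurable M" "AE x in M. h (T x) = f x"
proof -
  from assms(1) obtain N1 N2 where N: "N1 \<in> null_sets M" "N2 \<in> null_sets M"
    and bij: "bij_betw T (space M - N1) (space M - N2)"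
    and inv: "the_inv_into (space M - N1) T
      \<in> measurable (restrict_space M (space M - N2)) (restrict_space M (space M - N1))"
    unfolding measurably_bijective_mod_null_def by blast
  let ?S = "the_inv_into (space M - N1) T"
  define h where "h y = (if y \<in> space M - N2 then f (?S y) else 0)" for y
  have "?S \<in> measurable (restrict_space M (space M - N2)) M"
    using inv by (simp add: measurable_restrict_space2_iff)
  then have "(\<lambda>y. f (?S y)) \<in> borel_measurable (restrict_space M (space M - N2))"
    using f by (rule measurable_compose)
  then have "h \<in> borel_measurable M"
    unfolding h_def using N by (subst (asm) measurable_restrict_space_iff) auto
  moreover have "AE x in M. h (T x) = f x"
    using AE_not_in[OF N(1)] AE_space
  proof eventually_elim
    case (elim x)
    then have "T x \<in> space M - N2" "?S (T x) = x"
      using bij by (auto simp: bij_betw_def intro!: the_inv_into_f_f)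
    then show ?case by (simp add: h_def)
  qed
  ultimately show ?thesis using that by blast
qed

text \<open>The \<open>SOME\<close> in \<open>perron_frobenius\<close> yields its properties once a
  witness exists. The factor \<open>h\<close> is one: invariance of \<open>M\<close> carries
  integrability from \<open>h\<close> after \<open>T\<close> to \<open>h\<close>, and turns the
  integral of \<open>h * g\<close> into that of \<open>f\<close> times \<open>g\<close> after
  \<open>T\<close>.\<close>

lemma perron_frobenius_duality:
  assumes pres: "preserves_measure M T" and bij: "measurably_bijective_mod_null M T"
    and f: "f \<in> L1 M"
  shows "perron_frobenius M T f \<in> L1 M"
    and "g \<in> Linf M \<Longrightarrow>
      (\<integral>x. perron_frobenius M T f x * g x \<partial>M) = (\<integral>x. f x * g (T x) \<partial>M)"
proof -
  have T[measurable]: "T \<in> measurable M M" and distr: "distr M M T = M"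
    using pres by (auto simp: preserves_measure_def)
  have int: "integrable M f" and [measurable]: "f \<in> borel_measurable M"
    using f by (auto simp: L1_def)
  obtain h where h[measurable]: "h \<in> borel_measurable M" and hT: "AE x in M. h (T x) = f x"
    using bij_mod_null_obtain_factor[OF bij \<open>f \<in> borel_measurable M\<close>] .
  have "integrable M (\<lambda>x. h (T x))"
    using hT int by (subst integrable_cong_AE[of _ _ f]) measurable
  then have "integrable M h" using integrable_distr_eq[OF T h] distr by simp
  moreover have "(\<integral>x. h x * g x \<partial>M) = (\<integral>x. f x * g (T x) \<partial>M)" if "g \<in> Linf M" for g
  proof -
    have [measurable]: "g \<in> borel_measurable M" using that by (simp add: Linf_def)
    have "(\<integral>x. h x * g x \<partial>M) = (\<integral>x. h (T x) * g (T x) \<partial>M)"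
      using integral_distr[OF T, of "\<lambda>x. h x * g x"] distr by simp
    also have "\<dots> = (\<integral>x. f x * g (T x) \<partial>M)"
      using hT by (intro integral_cong_AE) auto
    finally show ?thesis .
  qed
  ultimately have "h \<in> L1 M \<and>
      (\<forall>g\<in>Linf M. (\<integral>x. h x * g x \<partial>M) = (\<integral>x. f x * g (T x) \<partial>M))"
    by (simp add: L1_def)
  from someI[of "\<lambda>h. h \<in> L1 M \<and>
      (\<forall>g\<in>Linf M. (\<integral>x. h x * g x \<partial>M) = (\<integral>x. f x * g (T x) \<partial>M))", OF this]
  show "perron_frobenius M T f \<in> L1 M"
    and "g \<in> Linf M \<Longrightarrow>
      (\<integral>x. perron_frobenius M T f x * g x \<partial>M) = (\<integral>x. f x * g (T x) \<partial>M)"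
    unfolding perron_frobenius_def by auto
qed

section \<open>Correlations of the cocycle with successive images of a set\<close>

lemma cocycle_iterate_in_L1:
  assumes "\<And>n. L1_operator M (P ((\<sigma> ^^ n) \<omega>))" "f \<in> L1 M"
  shows "cocycle_iterate \<sigma> P n \<omega> f \<in> L1 M"
  using assms by (induction n) (auto simp: L1_operator_def)

text \<open>Duality moves \<open>T\<close> onto the indicator of \<open>A (Suc n)\<close>, which
  turns it into that of \<open>A n\<close> almost everywhere. Each step of the cocycle is thus
  undone by one step of the sets.\<close>

lemma correlation_along_images:
  assumes pres: "preserves_measure M T" and bij: "measurably_bijective_mod_null M T"
    and L1op: "\<And>n. L1_operator M (P ((\<sigma> ^^ n) \<omega>))"
    and PF: "\<And>n. L1_operator_eq M (P ((\<sigma> ^^ n) \<omega>)) (perron_frobenius M T)"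
    and f: "f \<in> L1 M"
    and A[measurable]: "\<And>n. A n \<in> sets M"
    and image: "\<And>n. AE x in M. T x \<in> A (Suc n) \<longleftrightarrow> x \<in> A n"
  shows "(\<integral>x. cocycle_iterate \<sigma> P n \<omega> f x * indicator (A n) x \<partial>M)
    = (\<integral>x. f x * indicator (A 0) x \<partial>M)"
proof (induction n)
  case 0
  show ?case by simp
next
  case (Suc n)
  have [measurable]: "T \<in> measurable M M"
    using pres by (simp add: preserves_measure_def)
  let ?u = "cocycle_iterate \<sigma> P n \<omega> f"
  let ?Pu = "P ((\<sigma> ^^ n) \<omega>) ?u"
  let ?Lu = "perron_frobenius M T ?u"
  have u: "?u \<in> L1 M" using L1op f by (rule cocycle_iterate_in_L1)
  then have "?Pu \<in> L1 M" using L1op by (auto simp: L1_operator_def)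
  with u perron_frobenius_duality(1)[OF pres bij u]
  have [measurable]: "?u \<in> borel_measurable M" "?Pu \<in> borel_measurable M"
      "?Lu \<in> borel_measurable M"
    by (auto simp: L1_def)
  have eq: "AE x in M. ?Pu x = ?Lu x" using PF u by (auto simp: L1_operator_eq_def)
  have "(\<integral>x. ?Pu x * indicator (A (Suc n)) x \<partial>M) = (\<integral>x. ?Lu x * indicator (A (Suc n)) x \<partial>M)"
    using eq by (intro integral_cong_AE) auto
  also have "\<dots> = (\<integral>x. ?u x * indicator (A (Suc n)) (T x) \<partial>M)"
    by (rule perron_frobenius_duality(2)[OF pres bij u indicator_in_Linf[OF A]])
  also have "\<dots> = (\<integral>x. ?u x * indicator (A n) x \<partial>M)"
    using image[of n] by (intro integral_cong_AE) (auto simp: indicator_def)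
  finally show ?case using Suc by simp
qed

section \<open>A non-decaying correlation along one recurrent orbit\<close>

theorem theorem2p4:
  fixes M :: "'x measure" and \<Omega> :: "'w measure"
    and T :: "'x \<Rightarrow> 'x" and \<sigma> :: "'w \<Rightarrow> 'w" and \<Omega>0 :: "'w set"
    and P :: "'w \<Rightarrow> ('x \<Rightarrow> real) \<Rightarrow> ('x \<Rightarrow> real)"
  assumes "prob_space M" and "prob_space \<Omega>"
    and nontrivial: "\<exists>A\<in>sets M. 0 < measure M A \<and> measure M A < 1"
    and "preserves_measure \<Omega> \<sigma>"
    and "preserves_measure M T" and "measurably_bijective_mod_null M T"
    and "mixing_operator M (perron_frobenius M T)"
    and "\<Omega>0 \<in> sets \<Omega>" and "0 < measure \<Omega> \<Omega>0"
    and "\<forall>\<omega>\<in>\<Omega>0. forward_orbit \<sigma> \<omega> \<in> sets \<Omega> \<and> infinite (forward_orbit \<sigma> \<omega>)"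
    and "markov_operator_cocycle \<Omega> M P"
    and "\<forall>\<omega>\<in>\<Omega>0. \<forall>\<omega>'\<in>forward_orbit \<sigma> \<omega>. L1_operator_eq M (P \<omega>') (perron_frobenius M T)"
  shows "\<not> prior_mixing_inhomogeneous \<Omega> \<sigma> M P"
proof
  assume prior: "prior_mixing_inhomogeneous \<Omega> \<sigma> M P"
  interpret M: prob_space M by fact
  interpret \<Omega>: prob_space \<Omega> by fact
  have \<sigma>: "\<sigma> \<in> measurable \<Omega> \<Omega>"
    using \<open>preserves_measure \<Omega> \<sigma>\<close> by (simp add: preserves_measure_def)
  \<comment> \<open>Recurrence and prior mixing each fail only on a null set, while
    \<open>\<Omega>0\<close> has positive measure. Since the good set is independent of
    \<open>f\<close> and \<open>g\<close>, both may be built after \<open>\<omega>\<close> is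
    fixed.\<close>
  have "\<exists>\<omega>\<in>\<Omega>0. (\<forall>n. \<exists>k\<ge>n. (\<sigma> ^^ k) \<omega> \<in> \<Omega>0) \<and>
    (\<forall>f\<in>L1_zero M. \<forall>g\<in>bounded_observables \<Omega> M.
      (\<lambda>n. \<integral>x. cocycle_iterate \<sigma> P n \<omega> f x * g ((\<sigma> ^^ n) \<omega>) x \<partial>M) \<longlonglongrightarrow> 0)"
    (is "\<exists>\<omega>\<in>\<Omega>0. ?Q \<omega>")
  proof (rule ccontr)
    assume "\<not> ?thesis"
    moreover have "AE \<omega> in \<Omega>. \<omega> \<in> \<Omega>0 \<longrightarrow> ?Q \<omega>"
      using AE_infinitely_recurrent[OF \<open>prob_space \<Omega>\<close> \<open>preserves_measure \<Omega> \<sigma>\<close> \<open>\<Omega>0 \<in> sets \<Omega>\<close>]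
        prior[unfolded prior_mixing_inhomogeneous_def]
      by eventually_elim blast
    ultimately have "AE \<omega> in \<Omega>. \<omega> \<notin> \<Omega>0" by (elim eventually_mono) blast
    then have "measure \<Omega> \<Omega>0 = 0"
      using \<Omega>.prob_eq_0[OF \<open>\<Omega>0 \<in> sets \<Omega>\<close>] by simp
    with \<open>0 < measure \<Omega> \<Omega>0\<close> show False by simp
  qed
  then obtain \<omega> where \<omega>: "\<omega> \<in> \<Omega>0" and rec: "\<And>n. \<exists>k\<ge>n. (\<sigma> ^^ k) \<omega> \<in> \<Omega>0"
    and lim: "\<And>f g. f \<in> L1_zero M \<Longrightarrow> g \<in> bounded_observables \<Omega> M \<Longrightarrow>
      (\<lambda>n. \<integral>x. cocycle_iterate \<sigma> P n \<omega> f x * g ((\<sigma> ^^ n) \<omega>) x \<partial>M) \<longlonglongrightarrow> 0"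
    by blast
  have orbit: "forward_orbit \<sigma> \<omega>' \<in> sets \<Omega>" "infinite (forward_orbit \<sigma> \<omega>')"
    if "\<omega>' \<in> \<Omega>0" for \<omega>'
    using assms(10) that by auto
  have inj: "inj (\<lambda>n. (\<sigma> ^^ n) \<omega>)"
    by (rule inj_funpow_if_infinite_forward_orbit[OF orbit(2)[OF \<omega>]])
  \<comment> \<open>At a return time the orbit point lies in \<open>\<Omega>0\<close>, so its own
    forward orbit, a tail of the original one, is measurable.\<close>
  have singleton: "{(\<sigma> ^^ n) \<omega>} \<in> sets \<Omega>" for n
    using rec orbit(1) by (intro sets_singleton_forward_orbit[OF \<sigma> inj orbit(1)[OF \<omega>]]) blast
  have L1op: "L1_operator M (P ((\<sigma> ^^ n) \<omega>))" for n
    using \<open>markov_operator_cocycle \<Omega> M P\<close> sets.sets_into_space[OF singleton[of n]]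
    by (auto simp: markov_operator_cocycle_def)
  have PF: "L1_operator_eq M (P ((\<sigma> ^^ n) \<omega>)) (perron_frobenius M T)" for n
    using assms(12) \<omega> by (auto simp: forward_orbit_def)

  obtain A where A[measurable]: "A \<in> sets M" and "0 < measure M A" "measure M A < 1"
    using nontrivial by blast
  \<comment> \<open>\<open>F n\<close> stands for the n-th image of \<open>A\<close> under
    \<open>T\<close>, chosen step by step up to null sets. The clause for \<open>n = 0\<close> pins
    the start of the dependent choice.\<close>
  have "\<exists>F. \<forall>n. (F n \<in> sets M \<and> (n = 0 \<longrightarrow> F n = A)) \<and>
      (AE x in M. T x \<in> F (Suc n) \<longleftrightarrow> x \<in> F n)"
  proof (intro dependent_nat_choice)
    show "\<exists>B. B \<in> sets M \<and> (0 = 0 \<longrightarrow> B = A)" using A by blast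
    fix B and n :: nat
    assume "B \<in> sets M \<and> (n = 0 \<longrightarrow> B = A)"
    then obtain B' where "B' \<in> sets M" "AE x in M. T x \<in> B' \<longleftrightarrow> x \<in> B"
      using bij_mod_null_obtain_image[OF \<open>measurably_bijective_mod_null M T\<close>] by blast
    then show "\<exists>B'. (B' \<in> sets M \<and> (Suc n = 0 \<longrightarrow> B' = A)) \<and>
        (AE x in M. T x \<in> B' \<longleftrightarrow> x \<in> B)"
      by blast
  qed
  then obtain F where F: "\<And>n. F n \<in> sets M" "F 0 = A"
    and image: "\<And>n. AE x in M. T x \<in> F (Suc n) \<longleftrightarrow> x \<in> F n"
    by blast
  obtain g where g: "g \<in> bounded_observables \<Omega> M"
    and g_eq: "\<And>n. g ((\<sigma> ^^ n) \<omega>) = indicator (F n)"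
    using in_bounded_observables[of "\<lambda>n. (\<sigma> ^^ n) \<omega>" \<Omega> F M, OF singleton inj F(1)] by blast
  \<comment> \<open>Subtracting the mean of the indicator puts \<open>f\<close> into
    \<open>L1_zero M\<close>.\<close>
  define f :: "'x \<Rightarrow> real" where "f x = indicator A x - measure M A" for x
  have f: "f \<in> L1 M" by (auto simp: f_def[abs_def] L1_def M.emeasure_eq_measure)
  have "(\<integral>x. f x \<partial>M) = 0"
    unfolding f_def by (subst Bochner_Integration.integral_diff)
      (auto simp: M.emeasure_eq_measure M.prob_space)
  with f have "f \<in> L1_zero M" by (simp add: L1_zero_def)
  have "(\<integral>x. cocycle_iterate \<sigma> P n \<omega> f x * indicator (F n) x \<partial>M)
      = (\<integral>x. f x * indicator A x \<partial>M)" for n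
    using correlation_along_images[where P = P and \<sigma> = \<sigma> and \<omega> = \<omega> and A = F,
        OF assms(5,6) L1op PF f F(1) image]
    by (simp add: F(2))
  with lim[OF \<open>f \<in> L1_zero M\<close> g]
  have "(\<lambda>n::nat. \<integral>x. f x * indicator A x \<partial>M) \<longlonglongrightarrow> 0"
    by (simp add: g_eq)
  then have "(\<integral>x. f x * indicator A x \<partial>M) = 0" by (simp add: LIMSEQ_const_iff)
  \<comment> \<open>On \<open>A\<close> the function \<open>f\<close> is constantly
    \<open>1 - measure M A\<close>, so the constant correlation is a product of two positive
    numbers.\<close>
  moreover have "(\<integral>x. f x * indicator A x \<partial>M) = (\<integral>x. (1 - measure M A) * indicator A x \<partial>M)"
    by (intro Bochner_Integration.integral_cong) (auto simp: f_def indicator_def)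
  then have "(\<integral>x. f x * indicator A x \<partial>M) = (1 - measure M A) * measure M A"
    using A by (simp add: sets.Int_space_eq2)
  ultimately show False using \<open>0 < measure M A\<close> \<open>measure M A < 1\<close> by simp
qed

end
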